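(* For every $\lambda\in\mathbb{C}\setminus\{0\}$, the bifurcation measures $\mu^+_\lambda$ and $\mu^-_\lambda$ on $\mathrm{Per}_1(\lambda)^{cm}$ are distinct: $\mu^+_\lambda\neq\mu^-_\lambda$.
   Context: For $\lambda\in\mathbb{C}\setminus\{0\}$, $\mathrm{Per}_1(\lambda)^{cm}$ denotes the family $f_t(z)=\frac{\lambda z}{z^2+tz+1}$, parametrized by $t\in\mathbb{C}$ (so $\mathrm{Per}_1(\lambda)^{cm}$ is identified with $\mathbb{C}$). Each $f_t$ is a quadratic rational map with a fixed point at $0$ of multiplier $\lambda$ and critical points $c_\pm=\pm1$. Put $F_t(z_1,z_2)=(\lambda z_1z_2,\ z_1^2+tz_1z_2+z_2^2)$ and $$H^\pm_\lambda(t)=\lim_{n\to\infty}\frac1{2^n}\log\|F_t^n(\pm1,1)\|,\qquad t\in\mathbb{C},$$ where $F_t^n$ is the $n$-th iterate and $\|(z_1,z_2)\|=\max\{|z_1|,|z_2|\}$. The bifurcation measure of the critical point $\pm1$ is the positive measure $\mu^\pm_\lambda=\frac1{2\pi}\Delta H^\pm_\lambda$ on $\mathbb{C}$ (distributional Laplacian). *)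

theory Defs
  imports "HOL-Analysis.Analysis"
begin

text \<open>The homogeneous lift to \<open>\<complex> \<times> \<complex>\<close> of \<open>f\<^sub>t(z) = \<lambda>z / (z\<^sup>2 + tz + 1)\<close>.\<close>

definition per1_lift :: "complex \<Rightarrow> complex \<Rightarrow> complex \<times> complex \<Rightarrow> complex \<times> complex" where
  "per1_lift lam t = (\<lambda>(z1, z2). (lam * z1 * z2, z1\<^sup>2 + t * z1 * z2 + z2\<^sup>2))"

text \<open>The library norm on a product is Euclidean, so the maximum norm is written out.\<close>

definition max_norm :: "complex \<times> complex \<Rightarrow> real" where
  "max_norm = (\<lambda>(z1, z2). max (norm z1) (norm z2))"

text \<open>\<open>H\<^sup>\<plusminus>\<^sub>\<lambda>\<close> is the case \<open>c = \<plusminus>1\<close>. For \<open>\<lambda> \<noteq> 0\<close> the lift vanishes only at the origin,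
  so the logarithm is always taken of a positive number.\<close>

definition bif_potential :: "complex \<Rightarrow> complex \<Rightarrow> complex \<Rightarrow> real" where
  "bif_potential lam c t =
     lim (\<lambda>n. 1 / 2 ^ n * ln (max_norm ((per1_lift lam t ^^ n) (c, 1))))"

definition dir_deriv :: "complex \<Rightarrow> (complex \<Rightarrow> real) \<Rightarrow> complex \<Rightarrow> real" where
  "dir_deriv v f z = frechet_derivative f (at z) v"

text \<open>\<open>C\<^sup>\<infinity>\<close> in the real sense: every iterated directional derivative, including \<open>f\<close> itself,
  is Frechet differentiable over the reals. In particular all of them are continuous.\<close>

definition smooth :: "(complex \<Rightarrow> real) \<Rightarrow> bool" where
  "smooth f \<longleftrightarrow> (\<forall>vs. foldr dir_deriv vs f differentiable_on UNIV)"

definition test_function :: "(complex \<Rightarrow> real) \<Rightarrow> bool" where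
  "test_function f \<longleftrightarrow> smooth f \<and> compact (closure {z. f z \<noteq> 0})"

definition laplacian :: "(complex \<Rightarrow> real) \<Rightarrow> complex \<Rightarrow> real" where
  "laplacian f z = dir_deriv 1 (dir_deriv 1 f) z + dir_deriv \<i> (dir_deriv \<i> f) z"

definition distr_laplacian :: "(complex \<Rightarrow> real) \<Rightarrow> (complex \<Rightarrow> real) \<Rightarrow> real" where
  "distr_laplacian u f = (\<integral>z. u z * laplacian f z \<partial>lborel)"

text \<open>\<open>M = (1 / 2\<pi>) \<Delta>H\<close> for the potential \<open>H\<close> of the critical point \<open>c\<close>, as an equality of
  distributions. \<open>M\<close> is a positive Borel measure, finite on compact sets so that it does
  define a distribution; these conditions determine \<open>M\<close> uniquely.\<close>

definition is_bifurcation_measure :: "complex \<Rightarrow> complex \<Rightarrow> complex measure \<Rightarrow> bool" where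
  "is_bifurcation_measure lam c M \<longleftrightarrow>
     sets M = sets borel \<and>
     (\<forall>K. compact K \<longrightarrow> emeasure M K < \<infinity>) \<and>
     (\<forall>f. test_function f \<longrightarrow>
        (\<integral>z. f z \<partial>M) = 1 / (2 * pi) * distr_laplacian (bif_potential lam c) f)"

end

theory Submission
  imports Defs
begin

text \<open>
  Write \<open>H\<^sup>+\<close> and \<open>H\<^sup>-\<close> for the two potentials and \<open>u = H\<^sup>+ - H\<^sup>-\<close>. If the two measures agree, then the
  distributional Laplacian of \<open>u\<close> vanishes. The potentials are continuous and grow at most
  logarithmically, because \<open>ln \<parallel>F p\<parallel>\<close> differs from \<open>2 ln \<parallel>p\<parallel>\<close> by at most
  \<open>ln (C (1 + \<bar>t\<bar>))\<close>, where \<open>F\<close> is the lift (lemma \<open>escape_approx_Suc_dist\<close>). A continuous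
  weakly harmonic function of sublinear growth on the plane is constant (\<open>weakly_harmonic_sublinear_imp_constant\<close>), so \<open>u\<close> is
  constant. It is also odd, since \<open>z \<mapsto> -z\<close> conjugates the maps at \<open>t\<close> and \<open>-t\<close> and swaps the
  critical points (\<open>bif_potential_minus\<close>). Hence \<open>u = 0\<close>.

  This fails at \<open>t = -2\<close>. There the orbit of \<open>+1\<close> is \<open>1 \<mapsto> \<infinity> \<mapsto> 0\<close>, which gives
  \<open>H\<^sup>+(-2) = ln \<bar>\<lambda>\<bar> / 2\<close>, whereas an explicit lower bound for \<open>\<parallel>F p\<parallel> / \<parallel>p\<parallel>\<^sup>2\<close> gives
  \<open>H\<^sup>-(-2) > ln \<bar>\<lambda>\<bar> / 2\<close> for every \<open>\<lambda> \<noteq> 0\<close>.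

  The Liouville theorem is proved through a mean value property. For a bump function \<open>\<psi>\<^sub>r\<close> supported
  on the disc of radius \<open>r\<close> about \<open>a\<close> there is a radial kernel \<open>K\<^sub>r\<close> on that disc, of fixed positive
  mass, whose derivative in \<open>r\<close> is \<open>\<Delta>\<psi>\<^sub>r / (2 r)\<close> (\<open>DERIV_bump_kernel\<close>). So the mean of a weakly
  harmonic \<open>u\<close> against \<open>K\<^sub>r\<close> does not depend on \<open>r\<close>, and letting \<open>r\<close> tend to 0 identifies it with a multiple of \<open>u a\<close>.
  Comparing the means about two centres for large \<open>r\<close> shows that \<open>u\<close> is constant.
\<close>

section \<open>The potentials of the two critical points\<close>

lemma max_norm_pair: "max_norm (x, y) = max (norm x) (norm y)"
  by (simp add: max_norm_def)

lemma per1_lift_pair: "per1_lift lam t (x, y) = (lam * x * y, x\<^sup>2 + t * x * y + y\<^sup>2)"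
  by (simp add: per1_lift_def)

text \<open>For \<open>p \<noteq> 0\<close> and \<open>\<lambda> \<noteq> 0\<close>, the quotient of \<open>\<parallel>F p\<parallel>\<close> and \<open>\<parallel>p\<parallel>\<^sup>2\<close> and its reciprocal are bounded by affine functions of
  \<open>\<bar>t\<bar>\<close>; this controls the potentials uniformly on compact sets and at infinity.\<close>

lemma max_norm_per1_lift_le:
  "max_norm (per1_lift lam t p) \<le> (norm lam + norm t + 2) * (max_norm p)\<^sup>2"
proof (cases p)
  case (Pair x y)
  define m where "m = max_norm p"
  have m: "norm x \<le> m" "norm y \<le> m" "0 \<le> m"
    by (auto simp: m_def Pair max_norm_pair le_max_iff_disj)
  have prod: "norm x * norm y \<le> m\<^sup>2" "norm x * norm x \<le> m\<^sup>2" "norm y * norm y \<le> m\<^sup>2"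
    unfolding power2_eq_square using m by (auto intro!: mult_mono)
  have "norm (lam * x * y) \<le> norm lam * m\<^sup>2"
    using prod(1) by (simp add: norm_mult mult.assoc mult_left_mono)
  moreover have "norm (x\<^sup>2 + t * x * y + y\<^sup>2) \<le> m\<^sup>2 + norm t * m\<^sup>2 + m\<^sup>2"
    using prod by (intro order.trans[OF norm_triangle_ineq] add_mono)
      (auto simp: norm_mult power2_eq_square mult.assoc mult_left_mono)
  moreover have "0 \<le> norm lam * m\<^sup>2" "0 \<le> norm t * m\<^sup>2" "0 \<le> m\<^sup>2"
    by auto
  ultimately have "max (norm (lam * x * y)) (norm (x\<^sup>2 + t * x * y + y\<^sup>2))
      \<le> norm lam * m\<^sup>2 + norm t * m\<^sup>2 + 2 * m\<^sup>2"
    by linarith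
  then show ?thesis
    unfolding m_def[symmetric] by (simp add: Pair per1_lift_pair max_norm_pair distrib_right)
qed

text \<open>By the symmetry of both coordinates of the lift, let \<open>m\<close> be the larger and \<open>k\<close> the smaller of
  the two moduli. If \<open>k\<close> is comparable to \<open>m\<close>, the first coordinate is large; otherwise one square
  dominates the second coordinate.\<close>

lemma max_norm_per1_lift_ge:
  assumes "lam \<noteq> 0"
  shows "(max_norm p)\<^sup>2 \<le> (2 + 2 * (1 + norm t) / norm lam) * max_norm (per1_lift lam t p)"
proof (cases p)
  case (Pair x y)
  have key: "m\<^sup>2 \<le> (2 + 2 * (1 + norm t) / norm lam) *
      max (norm lam * (m * k)) (norm (x\<^sup>2 + t * x * y + y\<^sup>2))" (is "_ \<le> ?C * ?N")
    if k: "0 \<le> k" "k \<le> m" and low: "m\<^sup>2 - norm t * (m * k) - k\<^sup>2 \<le> norm (x\<^sup>2 + t * x * y + y\<^sup>2)"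
    for m k :: real
  proof (cases "m \<le> 2 * (1 + norm t) * k")
    case True
    have "m\<^sup>2 \<le> m * (2 * (1 + norm t) * k)"
      unfolding power2_eq_square using k True by (intro mult_left_mono) auto
    also have "\<dots> = 2 * (1 + norm t) / norm lam * (norm lam * (m * k))"
      using assms by simp
    also have "\<dots> \<le> ?C * ?N"
      using k by (intro mult_mono) auto
    finally show ?thesis .
  next
    case False
    have "norm t * (m * k) + k\<^sup>2 \<le> (1 + norm t) * k * m"
      using k mult_left_mono[of k m k] by (simp add: algebra_simps power2_eq_square)
    also have "\<dots> \<le> (m / 2) * m"
      using False k by (intro mult_right_mono) (auto simp: algebra_simps)
    finally have "m\<^sup>2 \<le> 2 * norm (x\<^sup>2 + t * x * y + y\<^sup>2)"
      using low by (simp add: power2_eq_square)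
    also have "\<dots> \<le> ?C * ?N"
      by (intro mult_mono) auto
    finally show ?thesis .
  qed
  have low: "norm (x\<^sup>2 + t * x * y + y\<^sup>2) \<ge> \<bar>(norm x)\<^sup>2 - (norm y)\<^sup>2\<bar> - norm t * (norm x * norm y)"
  proof -
    have "\<bar>(norm x)\<^sup>2 - (norm y)\<^sup>2\<bar> \<le> norm (x\<^sup>2 + y\<^sup>2)"
      using norm_triangle_ineq3[of "x\<^sup>2" "- y\<^sup>2"] by (simp add: norm_power)
    also have "\<dots> \<le> norm (x\<^sup>2 + t * x * y + y\<^sup>2) + norm (t * x * y)"
      using norm_triangle_ineq4[of "x\<^sup>2 + t * x * y + y\<^sup>2" "t * x * y"] by (simp add: algebra_simps)
    finally show ?thesis by (simp add: norm_mult mult.assoc)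
  qed
  show ?thesis
  proof (cases "norm x \<le> norm y")
    case True
    then show ?thesis
      using key[of "norm x" "norm y"] low
      by (simp add: Pair per1_lift_pair max_norm_pair norm_mult mult_ac max_absorb2)
  next
    case False
    then show ?thesis
      using key[of "norm y" "norm x"] low
      by (simp add: Pair per1_lift_pair max_norm_pair norm_mult mult_ac max_absorb1)
  qed
qed

text \<open>The sequence of normalised logarithms whose limit is the potential.\<close>

definition escape_approx :: "complex \<Rightarrow> complex \<Rightarrow> complex \<Rightarrow> nat \<Rightarrow> real" where
  "escape_approx lam c t n = 1 / 2 ^ n * ln (max_norm ((per1_lift lam t ^^ n) (c, 1)))"

lemma bif_potential_eq: "bif_potential lam c t = lim (escape_approx lam c t)"
  by (simp add: bif_potential_def escape_approx_def[abs_def])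

lemma max_norm_orbit_pos:
  assumes "lam \<noteq> 0"
  shows "0 < max_norm ((per1_lift lam t ^^ n) (c, 1))"
proof (induction n)
  case 0
  then show ?case by (simp add: max_norm_pair less_max_iff_disj)
next
  case (Suc n)
  have "0 < (max_norm ((per1_lift lam t ^^ n) (c, 1)))\<^sup>2" using Suc by simp
  also note max_norm_per1_lift_ge[OF assms, of _ t]
  finally have "0 < (2 + 2 * (1 + norm t) / norm lam) * max_norm ((per1_lift lam t ^^ Suc n) (c, 1))"
    by simp
  moreover have "0 < 2 + 2 * (1 + norm t) / norm lam"
    by (intro add_pos_nonneg) auto
  ultimately show ?case by (simp add: zero_less_mult_iff del: funpow.simps)
qed

lemma escape_approx_Suc_ge:
  assumes "lam \<noteq> 0" "0 < k" and low: "\<And>p. k * (max_norm p)\<^sup>2 \<le> max_norm (per1_lift lam t p)"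
  shows "escape_approx lam c t n + ln k / 2 ^ Suc n \<le> escape_approx lam c t (Suc n)"
proof -
  let ?m = "max_norm ((per1_lift lam t ^^ n) (c, 1))"
  have pos: "0 < ?m" "0 < max_norm ((per1_lift lam t ^^ Suc n) (c, 1))"
    using max_norm_orbit_pos[OF assms(1)] by blast+
  have "ln k + 2 * ln ?m = ln (k * ?m\<^sup>2)"
    using pos(1) assms(2) by (simp add: ln_mult ln_realpow)
  also have "\<dots> \<le> ln (max_norm ((per1_lift lam t ^^ Suc n) (c, 1)))"
    using pos assms(2) low by (subst ln_le_cancel_iff) auto
  finally show ?thesis
    using divide_right_mono[of _ _ "2 ^ Suc n :: real"]
    by (fastforce simp: escape_approx_def add_divide_distrib simp del: funpow.simps)
qed

lemma escape_approx_Suc_le: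
  assumes "lam \<noteq> 0" "0 < k" and up: "\<And>p. max_norm (per1_lift lam t p) \<le> k * (max_norm p)\<^sup>2"
  shows "escape_approx lam c t (Suc n) \<le> escape_approx lam c t n + ln k / 2 ^ Suc n"
proof -
  let ?m = "max_norm ((per1_lift lam t ^^ n) (c, 1))"
  have pos: "0 < ?m" "0 < max_norm ((per1_lift lam t ^^ Suc n) (c, 1))"
    using max_norm_orbit_pos[OF assms(1)] by blast+
  have "ln (max_norm ((per1_lift lam t ^^ Suc n) (c, 1))) \<le> ln (k * ?m\<^sup>2)"
    using pos assms(2) up
    by (subst ln_le_cancel_iff) auto
  also have "\<dots> = ln k + 2 * ln ?m"
    using pos(1) assms(2) by (simp add: ln_mult ln_realpow)
  finally show ?thesis
    using divide_right_mono[of _ _ "2 ^ Suc n :: real"]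
    by (fastforce simp: escape_approx_def add_divide_distrib simp del: funpow.simps)
qed

text \<open>For \<open>\<lambda> \<noteq> 0\<close>, \<open>lift_const lam * (1 + norm t)\<close> is an upper bound for \<open>\<parallel>F p\<parallel> / \<parallel>p\<parallel>\<^sup>2\<close> and for its
  reciprocal.\<close>

definition lift_const :: "complex \<Rightarrow> real" where
  "lift_const lam = norm lam + 4 + 2 / norm lam"

lemma lift_const_gt_1: "1 < lift_const lam"
  unfolding lift_const_def using norm_ge_zero[of lam] divide_nonneg_nonneg[of 2 "norm lam"] by linarith

lemma escape_approx_Suc_dist:
  assumes "lam \<noteq> 0"
  shows "\<bar>escape_approx lam c t (Suc n) - escape_approx lam c t n\<bar>
    \<le> ln (lift_const lam * (1 + norm t)) / 2 ^ Suc n"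
proof -
  let ?K = "lift_const lam * (1 + norm t)"
  have K: "0 < ?K"
    using lift_const_gt_1[of lam] by (intro mult_pos_pos add_pos_nonneg) auto
  have "norm lam + norm t + 2 \<le> ?K"
  proof -
    have "norm lam + norm t + 2 \<le> (norm lam + 4) * (1 + norm t)"
      by (simp add: algebra_simps)
    also have "\<dots> \<le> ?K" by (intro mult_right_mono) (auto simp: lift_const_def)
    finally show ?thesis .
  qed
  then have up: "max_norm (per1_lift lam t p) \<le> ?K * (max_norm p)\<^sup>2" for p
    by (intro order.trans[OF max_norm_per1_lift_le] mult_right_mono) auto
  have "2 + 2 * (1 + norm t) / norm lam \<le> (2 + 2 / norm lam) * (1 + norm t)"
    by (simp add: algebra_simps)
  also have "\<dots> \<le> ?K" by (intro mult_right_mono) (auto simp: lift_const_def)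
  finally have "(max_norm p)\<^sup>2 \<le> ?K * max_norm (per1_lift lam t p)" for p
    by (intro order.trans[OF max_norm_per1_lift_ge[OF assms, of p t]] mult_right_mono)
      (auto simp: max_norm_def split_beta le_max_iff_disj)
  then have low: "1 / ?K * (max_norm p)\<^sup>2 \<le> max_norm (per1_lift lam t p)" for p
    using K by (simp add: divide_le_eq mult.commute)
  have "0 < 1 / ?K" using K by simp
  from escape_approx_Suc_ge[OF assms this low, of c n] escape_approx_Suc_le[OF assms K up, of c n]
  have "escape_approx lam c t n + ln (1 / ?K) / 2 ^ Suc n \<le> escape_approx lam c t (Suc n)"
    "escape_approx lam c t (Suc n) \<le> escape_approx lam c t n + ln ?K / 2 ^ Suc n" .
  moreover have "ln (1 / ?K) = - ln ?K" using K ln_div[of 1 ?K] by auto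
  ultimately show ?thesis by (simp add: abs_le_iff)
qed

text \<open>The increments form a geometric series; \<open>1 / 2 ^ m - 1 / 2 ^ n\<close> is the sum of \<open>1 / 2 ^ Suc j\<close>
  over \<open>m \<le> j < n\<close>.\<close>

lemma escape_approx_dist:
  assumes "lam \<noteq> 0" "m \<le> n"
  shows "\<bar>escape_approx lam c t n - escape_approx lam c t m\<bar>
    \<le> ln (lift_const lam * (1 + norm t)) * (1 / 2 ^ m - 1 / 2 ^ n)"
  using assms(2)
proof (induction rule: dec_induct)
  case base
  then show ?case by simp
next
  case (step n)
  let ?B = "ln (lift_const lam * (1 + norm t))"
  have "\<bar>escape_approx lam c t (Suc n) - escape_approx lam c t m\<bar>
    \<le> ?B / 2 ^ Suc n + ?B * (1 / 2 ^ m - 1 / 2 ^ n)"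
    using escape_approx_Suc_dist[OF assms(1), of c t n] step.IH by linarith
  also have "\<dots> = ?B * (1 / 2 ^ m - 1 / 2 ^ Suc n)"
    by (simp add: field_simps)
  finally show ?case .
qed

lemma lift_bound_nonneg: "0 \<le> ln (lift_const lam * (1 + norm t))"
proof -
  have "1 * 1 \<le> lift_const lam * (1 + norm t)"
    using lift_const_gt_1[of lam] by (intro mult_mono) auto
  then show ?thesis by simp
qed

lemma eventually_divide_power_2_less:
  fixes B e :: real
  assumes "0 < e"
  shows "\<forall>\<^sub>F n in sequentially. B / 2 ^ n < e"
proof -
  have "(\<lambda>n. B * (1 / 2) ^ n) \<longlonglongrightarrow> B * 0"
    by (intro tendsto_mult tendsto_const LIMSEQ_power_zero) auto
  then have "(\<lambda>n. B / 2 ^ n) \<longlonglongrightarrow> 0"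
    by (simp add: power_one_over)
  then show ?thesis using assms by (rule order_tendstoD)
qed

lemma escape_approx_LIMSEQ:
  assumes "lam \<noteq> 0"
  shows "escape_approx lam c t \<longlonglongrightarrow> bif_potential lam c t"
proof -
  let ?B = "ln (lift_const lam * (1 + norm t))"
  have "Cauchy (escape_approx lam c t)"
  proof (rule metric_CauchyI)
    fix e :: real assume "0 < e"
    obtain N where N: "?B / 2 ^ N < e"
      using eventually_divide_power_2_less[OF \<open>0 < e\<close>, of ?B]
      by (auto simp: eventually_sequentially)
    have near: "\<bar>escape_approx lam c t n - escape_approx lam c t m\<bar> < e" if "N \<le> m" "m \<le> n" for m n
    proof -
      have "1 / 2 ^ m \<le> (1 / 2 ^ N :: real)"
        using that by (simp add: divide_simps)
      then have "?B * (1 / 2 ^ m - 1 / 2 ^ n) \<le> ?B * (1 / 2 ^ N)"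
        by (intro mult_left_mono lift_bound_nonneg) (simp add: diff_le_eq add_increasing2)
      with escape_approx_dist[OF assms that(2), of c t]
      have "\<bar>escape_approx lam c t n - escape_approx lam c t m\<bar> \<le> ?B * (1 / 2 ^ N)"
        by (rule order.trans)
      then show ?thesis using N by simp
    qed
    show "\<exists>M. \<forall>m\<ge>M. \<forall>n\<ge>M. dist (escape_approx lam c t m) (escape_approx lam c t n) < e"
    proof (intro exI allI impI)
      fix m n assume "N \<le> m" "N \<le> n"
      then show "dist (escape_approx lam c t m) (escape_approx lam c t n) < e"
        using near[of m n] near[of n m] by (cases "m \<le> n") (auto simp: dist_real_def abs_minus_commute)
    qed
  qed
  then show ?thesis
    unfolding bif_potential_eq by (simp add: Cauchy_convergent_iff convergent_LIMSEQ_iff)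
qed

lemma bif_potential_dist:
  assumes "lam \<noteq> 0"
  shows "\<bar>bif_potential lam c t - escape_approx lam c t m\<bar> \<le> ln (lift_const lam * (1 + norm t)) / 2 ^ m"
proof (rule tendsto_upperbound)
  show "(\<lambda>n. \<bar>escape_approx lam c t n - escape_approx lam c t m\<bar>) \<longlonglongrightarrow>
      \<bar>bif_potential lam c t - escape_approx lam c t m\<bar>"
    by (intro tendsto_intros escape_approx_LIMSEQ assms)
  show "\<forall>\<^sub>F n in sequentially. \<bar>escape_approx lam c t n - escape_approx lam c t m\<bar>
      \<le> ln (lift_const lam * (1 + norm t)) / 2 ^ m"
    using eventually_ge_at_top[of m]
  proof eventually_elim
    case (elim n)
    have "ln (lift_const lam * (1 + norm t)) * (1 / 2 ^ m - 1 / 2 ^ n) \<le> ln (lift_const lam * (1 + norm t)) * (1 / 2 ^ m)"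
      using lift_bound_nonneg by (intro mult_left_mono) auto
    with escape_approx_dist[OF assms elim, of c t] show ?case by simp
  qed
qed simp

text \<open>The starting vector has maximum norm 1, so the zeroth approximant vanishes and the potential grows
  at most logarithmically.\<close>

lemma bif_potential_growth:
  assumes "lam \<noteq> 0" "norm c = 1"
  shows "\<bar>bif_potential lam c t\<bar> \<le> ln (lift_const lam * (1 + norm t))"
  using bif_potential_dist[OF assms(1), of c t 0] assms(2)
  by (simp add: escape_approx_def max_norm_pair)

lemma continuous_on_escape_approx:
  assumes "lam \<noteq> 0"
  shows "continuous_on S (\<lambda>t. escape_approx lam c t n)"
proof -
  have "continuous_on S (\<lambda>t. (per1_lift lam t ^^ n) (c, 1))"
    by (induction n) (auto simp: per1_lift_def split_beta intro!: continuous_intros)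
  then show ?thesis
    unfolding escape_approx_def max_norm_def split_beta
    using max_norm_orbit_pos[OF assms, of n _ c, THEN less_imp_neq]
    by (intro continuous_intros) (auto simp: max_norm_def split_beta)
qed

lemma continuous_on_bif_potential:
  assumes "lam \<noteq> 0"
  shows "continuous_on UNIV (bif_potential lam c)"
proof -
  have "continuous_on (ball 0 R) (bif_potential lam c)" for R :: real
  proof (rule uniform_limit_theorem)
    show "\<forall>\<^sub>F n in sequentially. continuous_on (ball 0 R) (\<lambda>t. escape_approx lam c t n)"
      using continuous_on_escape_approx[OF assms] by simp
    show "uniform_limit (ball 0 R) (\<lambda>n t. escape_approx lam c t n) (bif_potential lam c) sequentially"
    proof (rule uniform_limitI)
      fix e :: real assume "0 < e"
      define B where "B = ln (lift_const lam * (1 + R))"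
      from eventually_divide_power_2_less[OF \<open>0 < e\<close>, of B] show "\<forall>\<^sub>F n in sequentially. \<forall>t\<in>ball 0 R. dist (escape_approx lam c t n) (bif_potential lam c t) < e"
      proof eventually_elim
        case (elim n)
        show ?case
        proof
          fix t :: complex assume "t \<in> ball 0 R"
          then have "lift_const lam * (1 + norm t) \<le> lift_const lam * (1 + R)"
            using lift_const_gt_1[of lam] by (intro mult_left_mono) auto
          moreover have "0 < lift_const lam * (1 + norm t)"
            using lift_const_gt_1[of lam] by (intro mult_pos_pos add_pos_nonneg) auto
          ultimately have "ln (lift_const lam * (1 + norm t)) \<le> B"
            unfolding B_def by simp
          then have "ln (lift_const lam * (1 + norm t)) / 2 ^ n \<le> B / 2 ^ n"
            by (simp add: divide_right_mono)
          with elim bif_potential_dist[OF assms, of c t n]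
          show "dist (escape_approx lam c t n) (bif_potential lam c t) < e"
            by (simp add: dist_real_def abs_minus_commute)
        qed
      qed
    qed
  qed simp
  then have "continuous_on (\<Union>R. ball 0 R) (bif_potential lam c)"
    by (intro continuous_on_open_UN) auto
  moreover have "(\<Union>R. ball 0 R) = (UNIV :: complex set)"
    by (auto intro: gt_ex)
  ultimately show ?thesis by simp
qed

text \<open>The map \<open>(x, y) \<mapsto> (-x, y)\<close> conjugates the lifts at \<open>t\<close> and \<open>-t\<close> and swaps the critical points.\<close>

lemma bif_potential_minus: "bif_potential lam (- c) (- t) = bif_potential lam c t"
proof -
  have "(per1_lift lam (- t) ^^ n) (- c, 1) = (case (per1_lift lam t ^^ n) (c, 1) of (x, y) \<Rightarrow> (- x, y))" for n
    by (induction n) (auto simp: per1_lift_pair split: prod.splits)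
  then have "max_norm ((per1_lift lam (- t) ^^ n) (- c, 1)) = max_norm ((per1_lift lam t ^^ n) (c, 1))" for n
    by (simp add: max_norm_def split: prod.splits)
  then show ?thesis
    by (simp add: bif_potential_eq escape_approx_def[abs_def])
qed

text \<open>At \<open>t = -2\<close> the critical point 1 is a pole and is sent to the fixed point 0 in two steps, so its
  orbit under the lift is explicit.\<close>

lemma bif_potential_plus_at_minus_2:
  assumes "lam \<noteq> 0"
  shows "bif_potential lam 1 (-2) = ln (norm lam) / 2"
proof -
  have orbit: "(per1_lift lam (-2) ^^ (n + 2)) (1, 1) = (0, lam ^ (2 ^ (n + 1)))" for n
  proof (induction n)
    case 0
    then show ?case by (simp add: per1_lift_pair numeral_2_eq_2)
  next
    case (Suc n)
    have "(lam ^ (2 ^ (n + 1)))\<^sup>2 = lam ^ (2 ^ (Suc n + 1))"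
      by (simp add: power_mult[symmetric] mult.commute)
    with Suc show ?case by (simp add: per1_lift_pair)
  qed
  have "escape_approx lam 1 (-2) (n + 2) = ln (norm lam) / 2" for n
    unfolding escape_approx_def orbit using assms
    by (simp add: max_norm_pair norm_power ln_realpow max_def field_simps)
  then have "(\<lambda>n. escape_approx lam 1 (-2) (n + 2)) \<longlonglongrightarrow> ln (norm lam) / 2"
    by (simp only: tendsto_const)
  then have "escape_approx lam 1 (-2) \<longlonglongrightarrow> ln (norm lam) / 2"
    by (rule LIMSEQ_offset)
  then show ?thesis
    using escape_approx_LIMSEQ[OF assms] LIMSEQ_unique by blast
qed

text \<open>A lower bound \<open>k\<close> for \<open>\<parallel>F p\<parallel> / \<parallel>p\<parallel>\<^sup>2\<close> at a single \<open>t\<close> bounds the potential there below in terms of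
  any of its approximants.\<close>

lemma bif_potential_ge:
  assumes "lam \<noteq> 0" "0 < k" and low: "\<And>p. k * (max_norm p)\<^sup>2 \<le> max_norm (per1_lift lam t p)"
  shows "escape_approx lam c t m + ln k / 2 ^ m \<le> bif_potential lam c t"
proof -
  have step: "escape_approx lam c t m + ln k * (1 / 2 ^ m - 1 / 2 ^ n) \<le> escape_approx lam c t n"
    if "m \<le> n" for n
    using that
  proof (induction rule: dec_induct)
    case base
    then show ?case by simp
  next
    case (step n)
    have "ln k * (1 / 2 ^ m - 1 / 2 ^ Suc n) = ln k * (1 / 2 ^ m - 1 / 2 ^ n) + ln k / 2 ^ Suc n"
      by (simp add: field_simps)
    with step.IH escape_approx_Suc_ge[OF assms, of c n] show ?case by linarith
  qed
  have "(\<lambda>n. escape_approx lam c t m + ln k * (1 / 2 ^ m - (1 / 2) ^ n)) \<longlonglongrightarrow>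
      escape_approx lam c t m + ln k * (1 / 2 ^ m - 0)"
    by (intro tendsto_intros LIMSEQ_power_zero) auto
  moreover have "\<exists>N. \<forall>n\<ge>N. escape_approx lam c t m + ln k * (1 / 2 ^ m - (1 / 2) ^ n) \<le> escape_approx lam c t n"
    using step by (auto simp: power_one_over)
  ultimately show ?thesis
    using LIMSEQ_le[OF _ escape_approx_LIMSEQ[OF assms(1)]] by simp
qed

text \<open>At \<open>t = -2\<close> the second coordinate of the lift is \<open>(x - y)\<^sup>2\<close>, and \<open>\<parallel>F p\<parallel> \<ge> k \<parallel>p\<parallel>\<^sup>2\<close> holds with
  \<open>k = min \<bar>\<lambda>\<bar> 1 / 3\<close>. The orbit of the other critical point starts with
  \<open>(-1, 1)\<close>, \<open>(-\<lambda>, 4)\<close>, \<open>(-4\<lambda>\<^sup>2, (\<lambda> + 4)\<^sup>2)\<close>. For \<open>\<bar>\<lambda>\<bar> \<le> 1\<close> the first iterate has norm at least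
  \<open>4\<close> and \<open>4 k > \<bar>\<lambda>\<bar>\<close>; for \<open>\<bar>\<lambda>\<bar> > 1\<close> the second has norm at least \<open>4 \<bar>\<lambda>\<bar>\<^sup>2\<close> and \<open>4 k > 1\<close>.\<close>

lemma bif_potential_minus_at_minus_2:
  assumes "lam \<noteq> 0"
  shows "ln (norm lam) / 2 < bif_potential lam (-1) (-2)"
proof -
  define k where "k = min (norm lam) 1 / 3"
  have k: "0 < k" using assms by (simp add: k_def)
  have low: "k * (max_norm p)\<^sup>2 \<le> max_norm (per1_lift lam (-2) p)" for p
  proof (cases p)
    case (Pair x y)
    have key: "k * m\<^sup>2 \<le> max (norm lam * (m * l)) ((norm (x - y))\<^sup>2)"
      if "0 \<le> l" "l \<le> m" "m - l \<le> norm (x - y)" for m l :: real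
    proof (cases "m \<le> 3 * l")
      case True
      have "k * m\<^sup>2 \<le> norm lam / 3 * (m * (3 * l))"
        unfolding power2_eq_square using True that by (intro mult_mono) (auto simp: k_def)
      then show ?thesis by simp
    next
      case False
      have "k * m\<^sup>2 \<le> (2 / 3)\<^sup>2 * m\<^sup>2"
        by (intro mult_right_mono) (auto simp: k_def power2_eq_square)
      also have "\<dots> = (2 / 3 * m)\<^sup>2" by (simp only: power_mult_distrib)
      also have "\<dots> \<le> (norm (x - y))\<^sup>2"
        using False that by (intro power_mono) auto
      finally show ?thesis by simp
    qed
    have "x\<^sup>2 + - 2 * x * y + y\<^sup>2 = (x - y)\<^sup>2"
      by (simp add: power2_eq_square algebra_simps)
    then have F: "max_norm (per1_lift lam (-2) p) = max (norm lam * (norm x * norm y)) ((norm (x - y))\<^sup>2)"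
      by (simp only: Pair per1_lift_pair max_norm_pair norm_mult norm_power mult.assoc)
    have near: "\<bar>norm x - norm y\<bar> \<le> norm (x - y)" by (rule norm_triangle_ineq3)
    show ?thesis
    proof (cases "norm x \<le> norm y")
      case True
      then have "k * (norm y)\<^sup>2 \<le> max_norm (per1_lift lam (-2) p)"
        unfolding F mult.commute[of "norm x"]
        by (intro key norm_ge_zero) (use near in linarith)+
      with True show ?thesis by (simp add: Pair max_norm_pair max_absorb2)
    next
      case False
      then have "k * (norm x)\<^sup>2 \<le> max_norm (per1_lift lam (-2) p)"
        unfolding F by (intro key norm_ge_zero) (use near in linarith)+
      with False show ?thesis by (simp add: Pair max_norm_pair max_absorb1)
    qed
  qed
  note ge = bif_potential_ge[OF assms k low, of "-1"]
  show ?thesis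
  proof (cases "norm lam \<le> 1")
    case True
    have "ln (norm lam) < ln (4 * k)"
      using assms True by (subst ln_less_cancel_iff) (auto simp: k_def)
    also have "\<dots> = ln 4 + ln k"
      using k by (subst ln_mult) auto
    also have "\<dots> \<le> ln (max_norm ((per1_lift lam (-2) ^^ 1) (-1, 1))) + ln k"
      by (simp add: per1_lift_pair max_norm_pair le_max_iff_disj)
    also have "\<dots> / 2 \<le> bif_potential lam (-1) (-2)"
      using ge[of 1] by (simp add: escape_approx_def add_divide_distrib)
    finally show ?thesis by simp
  next
    case False
    have "2 * ln (norm lam) = ln ((norm lam)\<^sup>2)"
      using assms by (simp add: ln_realpow)
    also have "\<dots> < ln (4 * (norm lam)\<^sup>2 * k)"
      using assms False by (subst ln_less_cancel_iff) (auto simp: k_def)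
    also have "\<dots> = ln (4 * (norm lam)\<^sup>2) + ln k"
      using assms k by (subst ln_mult) auto
    also have "\<dots> \<le> ln (max_norm ((per1_lift lam (-2) ^^ 2) (-1, 1))) + ln k"
      using assms
      by (simp add: per1_lift_pair max_norm_pair le_max_iff_disj numeral_2_eq_2 norm_mult
          less_max_iff_disj power2_eq_square)
    also have "\<dots> / 4 \<le> bif_potential lam (-1) (-2)"
      using ge[of 2] by (simp add: escape_approx_def add_divide_distrib)
    finally show ?thesis by simp
  qed
qed

section \<open>Smooth bump functions on the plane\<close>

text \<open>The functions \<open>exp (- 1 / x) / x ^ k\<close>, extended by zero to \<open>x \<le> 0\<close>. The case \<open>k = 0\<close> is the classical
  flat function, and the family is closed under differentiation up to linear combinations.\<close>

definition flat_exp :: "nat \<Rightarrow> real \<Rightarrow> real" where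
  "flat_exp k x = (if 0 < x then exp (- (1 / x)) / x ^ k else 0)"

lemma flat_exp_eq_0: "x \<le> 0 \<Longrightarrow> flat_exp k x = 0"
  by (simp add: flat_exp_def)

lemma flat_exp_nonneg: "0 \<le> flat_exp k x"
  by (simp add: flat_exp_def)

lemma tendsto_flat_exp_0: "(flat_exp k \<longlongrightarrow> 0) (at 0)"
proof (rule filterlim_split_at)
  show "(flat_exp k \<longlongrightarrow> 0) (at_left 0)"
    by (rule tendsto_eventually) (auto simp: eventually_at_filter flat_exp_eq_0)
  have "((\<lambda>x. (inverse x) ^ k / exp (inverse x)) \<longlongrightarrow> 0) (at_right (0::real))"
    by (rule filterlim_compose[OF tendsto_power_div_exp_0 filterlim_inverse_at_top_right])
  moreover have "\<forall>\<^sub>F x in at_right 0. (inverse x) ^ k / exp (inverse x) = flat_exp k x"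
    by (auto simp: eventually_at_filter flat_exp_def exp_minus field_simps)
  ultimately show "(flat_exp k \<longlongrightarrow> 0) (at_right 0)"
    by (rule Lim_transform_eventually)
qed

lemma DERIV_flat_exp:
  "(flat_exp k has_real_derivative flat_exp (k + 2) x - real k * flat_exp (k + 1) x) (at x)"
proof (cases x "0::real" rule: linorder_cases)
  case less
  have "((\<lambda>_. 0) has_real_derivative flat_exp (k + 2) x - real k * flat_exp (k + 1) x) (at x)"
    using less by (simp add: flat_exp_eq_0)
  then show ?thesis
    by (rule has_field_derivative_transform_within_open[of _ _ _ "{..<0}"])
      (use less in \<open>auto simp: flat_exp_eq_0\<close>)
next
  case equal
  have "(\<lambda>h. (flat_exp k (0 + h) - flat_exp k 0) / h) = flat_exp (Suc k)"
    by (auto simp: fun_eq_iff flat_exp_def)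
  then show ?thesis
    using tendsto_flat_exp_0[of "Suc k"] by (simp add: DERIV_def equal flat_exp_eq_0)
next
  case greater
  have "((\<lambda>x. exp (- (1 / x)) / x ^ k) has_real_derivative
      (exp (- (1 / x)) * (1 / x\<^sup>2) * x ^ k - exp (- (1 / x)) * (real k * x ^ (k - 1))) / (x ^ k * x ^ k)) (at x)"
    using greater by (auto intro!: derivative_eq_intros simp: power2_eq_square)
  moreover have "(exp (- (1 / x)) * (1 / x\<^sup>2) * x ^ k - exp (- (1 / x)) * (real k * x ^ (k - 1))) / (x ^ k * x ^ k)
      = flat_exp (k + 2) x - real k * flat_exp (k + 1) x"
    using greater by (cases k) (auto simp: flat_exp_def field_simps power2_eq_square)
  ultimately have "((\<lambda>x. exp (- (1 / x)) / x ^ k) has_real_derivative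
      flat_exp (k + 2) x - real k * flat_exp (k + 1) x) (at x)" by simp
  then show ?thesis
    by (rule has_field_derivative_transform_within_open[of _ _ _ "{0<..}"])
      (use greater in \<open>auto simp: flat_exp_def\<close>)
qed

lemma continuous_on_flat_exp [continuous_intros]:
  assumes "continuous_on S f"
  shows "continuous_on S (\<lambda>x. flat_exp k (f x))"
proof -
  have "continuous_on UNIV (flat_exp k)"
    using DERIV_flat_exp DERIV_isCont by (blast intro: continuous_at_imp_continuous_on)
  then show ?thesis
    by (rule continuous_on_compose2[OF _ assms]) auto
qed

text \<open>The function \<open>1 - \<bar>z - a\<bar>\<^sup>2 / r\<^sup>2\<close>, positive exactly on the open disc of radius \<open>r\<close> about \<open>a\<close>
  when \<open>r > 0\<close>.\<close>

definition paraboloid :: "complex \<Rightarrow> real \<Rightarrow> complex \<Rightarrow> real" where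
  "paraboloid a r z = 1 - (z - a) \<bullet> (z - a) / r\<^sup>2"

lemma paraboloid_nonpos: "0 < r \<Longrightarrow> r \<le> norm (z - a) \<Longrightarrow> paraboloid a r z \<le> 0"
  by (simp add: paraboloid_def dot_square_norm)

lemma has_derivative_paraboloid:
  "(paraboloid a r has_derivative (\<lambda>v. - 2 * ((z - a) \<bullet> v) / r\<^sup>2)) (at z)"
proof -
  have "((\<lambda>z. 1 - inverse (r\<^sup>2) * ((z - a) \<bullet> (z - a))) has_derivative
      (\<lambda>v. - 2 * ((z - a) \<bullet> v) / r\<^sup>2)) (at z)"
    by (auto intro!: derivative_eq_intros simp: inner_commute divide_inverse)
  then show ?thesis
    by (simp add: paraboloid_def[abs_def] divide_inverse mult.commute)
qed

lemma has_derivative_flat_exp_paraboloid: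
  "((\<lambda>z. flat_exp k (paraboloid a r z)) has_derivative
    (\<lambda>v. (flat_exp (k + 2) (paraboloid a r z) - real k * flat_exp (k + 1) (paraboloid a r z))
      * (- 2 * ((z - a) \<bullet> v) / r\<^sup>2))) (at z)"
  using has_derivative_compose[OF has_derivative_paraboloid[of a r z]
      DERIV_flat_exp[THEN has_field_derivative_imp_has_derivative, of k]]
  by simp

text \<open>A ring of functions containing the bump functions and closed under all directional derivatives
  (\<open>bump_ring_derivative\<close>); such a ring consists of smooth functions.\<close>

inductive_set bump_ring :: "complex \<Rightarrow> real \<Rightarrow> (complex \<Rightarrow> real) set" for a r where
  const: "(\<lambda>_. c) \<in> bump_ring a r"
| inner: "(\<lambda>z. (z - a) \<bullet> v) \<in> bump_ring a r"
| flat: "(\<lambda>z. flat_exp k (paraboloid a r z)) \<in> bump_ring a r"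
| add: "f \<in> bump_ring a r \<Longrightarrow> g \<in> bump_ring a r \<Longrightarrow> (\<lambda>z. f z + g z) \<in> bump_ring a r"
| mult: "f \<in> bump_ring a r \<Longrightarrow> g \<in> bump_ring a r \<Longrightarrow> (\<lambda>z. f z * g z) \<in> bump_ring a r"

lemma bump_ring_derivative:
  assumes "f \<in> bump_ring a r"
  shows "\<exists>f'. (\<forall>v. f' v \<in> bump_ring a r) \<and> (\<forall>z. (f has_derivative (\<lambda>v. f' v z)) (at z))"
  using assms
proof induction
  case (const c)
  show ?case
    by (rule exI[of _ "\<lambda>_ _. 0"]) (auto intro: bump_ring.const)
next
  case (inner w)
  show ?case
    by (rule exI[of _ "\<lambda>v _. v \<bullet> w"]) (auto intro!: bump_ring.const derivative_eq_intros)
next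
  case (flat k)
  have "(\<lambda>z. (flat_exp (k + 2) (paraboloid a r z) + (- real k) * flat_exp (k + 1) (paraboloid a r z))
      * ((- 2 / r\<^sup>2) * ((z - a) \<bullet> v))) \<in> bump_ring a r" for v
    by (intro bump_ring.intros)
  then show ?case
    using has_derivative_flat_exp_paraboloid[of k a r]
    by (intro exI[of _ "\<lambda>v z. (flat_exp (k + 2) (paraboloid a r z) + (- real k) * flat_exp (k + 1) (paraboloid a r z))
      * ((- 2 / r\<^sup>2) * ((z - a) \<bullet> v))"]) simp
next
  case (add f g)
  then obtain f' g' where
    "\<forall>v. f' v \<in> bump_ring a r" "\<forall>z. (f has_derivative (\<lambda>v. f' v z)) (at z)"
    "\<forall>v. g' v \<in> bump_ring a r" "\<forall>z. (g has_derivative (\<lambda>v. g' v z)) (at z)"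
    by blast
  then show ?case
    by (intro exI[of _ "\<lambda>v z. f' v z + g' v z"])
      (auto intro!: bump_ring.add has_derivative_add)
next
  case (mult f g)
  then obtain f' g' where
    "\<forall>v. f' v \<in> bump_ring a r" "\<forall>z. (f has_derivative (\<lambda>v. f' v z)) (at z)"
    "\<forall>v. g' v \<in> bump_ring a r" "\<forall>z. (g has_derivative (\<lambda>v. g' v z)) (at z)"
    by blast
  with mult.hyps show ?case
    by (intro exI[of _ "\<lambda>v z. f z * g' v z + f' v z * g z"])
      (auto intro!: bump_ring.add bump_ring.mult has_derivative_mult)
qed

lemma dir_deriv_eq: "(f has_derivative f') (at z) \<Longrightarrow> dir_deriv v f z = f' v"
  unfolding dir_deriv_def by (simp add: frechet_derivative_at[symmetric])

lemma bump_ring_smooth: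
  assumes "f \<in> bump_ring a r"
  shows "smooth f"
  unfolding smooth_def
proof
  fix vs
  have "foldr dir_deriv vs f \<in> bump_ring a r"
  proof (induction vs)
    case Nil
    then show ?case using assms by simp
  next
    case (Cons v vs)
    from bump_ring_derivative[OF this] obtain f' where f': "\<forall>v. f' v \<in> bump_ring a r"
      "\<forall>z. (foldr dir_deriv vs f has_derivative (\<lambda>v. f' v z)) (at z)" by blast
    then have "dir_deriv v (foldr dir_deriv vs f) z = f' v z" for z
      by (intro dir_deriv_eq) blast
    then have "dir_deriv v (foldr dir_deriv vs f) = f' v" ..
    with f' show ?case by simp
  qed
  from bump_ring_derivative[OF this] show "foldr dir_deriv vs f differentiable_on UNIV"
    by (auto simp: differentiable_on_def differentiable_def)
qed

text \<open>The standard bump function on the disc of radius \<open>r\<close> about \<open>a\<close>.\<close>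

definition bump :: "complex \<Rightarrow> real \<Rightarrow> complex \<Rightarrow> real" where
  "bump a r z = flat_exp 0 (paraboloid a r z)"

lemma test_function_bump:
  assumes "0 < r"
  shows "test_function (bump a r)"
proof -
  have "smooth (bump a r)"
    unfolding bump_def[abs_def] by (rule bump_ring_smooth, rule bump_ring.flat)
  moreover have "bounded {z. bump a r z \<noteq> 0}"
  proof (rule bounded_subset[OF bounded_cball])
    show "{z. bump a r z \<noteq> 0} \<subseteq> cball a r"
      using paraboloid_nonpos[OF assms] flat_exp_eq_0
      by (auto simp: bump_def dist_norm norm_minus_commute intro: ccontr)
  qed
  ultimately show ?thesis
    by (simp add: test_function_def compact_closure)
qed

lemma laplacian_bump:
  "laplacian (bump a r) z =
    4 * (norm (z - a))\<^sup>2 / r ^ 4 * (flat_exp 4 (paraboloid a r z) - 2 * flat_exp 3 (paraboloid a r z))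
    - 4 / r\<^sup>2 * flat_exp 2 (paraboloid a r z)"
proof -
  have first: "dir_deriv v (bump a r) = (\<lambda>z. flat_exp 2 (paraboloid a r z) * (- 2 * ((z - a) \<bullet> v) / r\<^sup>2))" for v
    unfolding bump_def[abs_def]
    by (rule ext, subst dir_deriv_eq[OF has_derivative_flat_exp_paraboloid]) (simp add: numeral_2_eq_2)
  have second: "dir_deriv v (dir_deriv v (bump a r)) z =
      4 * ((z - a) \<bullet> v)\<^sup>2 / r ^ 4 * (flat_exp 4 (paraboloid a r z) - 2 * flat_exp 3 (paraboloid a r z))
      - 2 * (v \<bullet> v) / r\<^sup>2 * flat_exp 2 (paraboloid a r z)" for v
  proof -
    have "((\<lambda>z. - 2 / r\<^sup>2 * ((z - a) \<bullet> v)) has_derivative (\<lambda>w. - 2 / r\<^sup>2 * (w \<bullet> v))) (at z)"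
      by (intro has_derivative_mult_right) (auto intro!: derivative_eq_intros)
    then have "((\<lambda>z. - 2 * ((z - a) \<bullet> v) / r\<^sup>2) has_derivative (\<lambda>w. - 2 * (w \<bullet> v) / r\<^sup>2)) (at z)"
      by simp
    from dir_deriv_eq[OF has_derivative_mult[OF has_derivative_flat_exp_paraboloid[of 2] this], of v]
    have "dir_deriv v (dir_deriv v (bump a r)) z =
        flat_exp 2 (paraboloid a r z) * (- 2 * (v \<bullet> v) / r\<^sup>2)
        + (flat_exp 4 (paraboloid a r z) - 2 * flat_exp 3 (paraboloid a r z))
          * (- 2 * ((z - a) \<bullet> v) / r\<^sup>2) * (- 2 * ((z - a) \<bullet> v) / r\<^sup>2)"
      unfolding first by simp
    moreover have "F2 * (- 2 * N / r\<^sup>2) + (F4 - 2 * F3) * (- 2 * X / r\<^sup>2) * (- 2 * X / r\<^sup>2)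
        = 4 * X\<^sup>2 / r ^ 4 * (F4 - 2 * F3) - 2 * N / r\<^sup>2 * F2" for F2 F3 F4 N X :: real
      by (simp add: power2_eq_square power4_eq_xxxx algebra_simps diff_divide_distrib)
    ultimately show ?thesis by simp
  qed
  have "((z - a) \<bullet> 1)\<^sup>2 + ((z - a) \<bullet> \<i>)\<^sup>2 = (norm (z - a))\<^sup>2"
    by (simp add: inner_complex_def cmod_power2)
  moreover have "4 * X / s * D - 2 * 1 / t * F + (4 * Y / s * D - 2 * 1 / t * F) = 4 * (X + Y) / s * D - 4 / t * F"
    for X Y s t D F :: real
    by (simp add: add_divide_distrib algebra_simps)
  moreover have "(1 :: complex) \<bullet> 1 = 1" "\<i> \<bullet> \<i> = 1"
    by (simp_all add: inner_complex_def)
  ultimately show ?thesis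
    unfolding laplacian_def second by simp
qed

section \<open>Mean values and the Liouville theorem for weakly harmonic functions\<close>

lemma continuous_on_paraboloid [continuous_intros]:
  assumes "continuous_on S f" "continuous_on S g" "\<And>x. x \<in> S \<Longrightarrow> g x \<noteq> 0"
  shows "continuous_on S (\<lambda>x. paraboloid a (g x) (f x))"
  unfolding paraboloid_def using assms by (intro continuous_intros) auto

text \<open>A radial kernel on the disc of radius \<open>r\<close> about \<open>a\<close>. It is the derivative
  \<open>flat_exp 2\<close> of \<open>flat_exp 0\<close> evaluated at the paraboloid, scaled so that the total mass does not
  depend on \<open>r > 0\<close>.\<close>

definition bump_kernel :: "complex \<Rightarrow> real \<Rightarrow> complex \<Rightarrow> real" where
  "bump_kernel a r z = flat_exp 2 (paraboloid a r z) / r\<^sup>2"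

lemma laplacian_bump_eq_0: "0 < r \<Longrightarrow> r \<le> norm (z - a) \<Longrightarrow> laplacian (bump a r) z = 0"
  by (simp add: laplacian_bump flat_exp_eq_0 paraboloid_nonpos)

lemma bump_kernel_eq_0: "0 < r \<Longrightarrow> r \<le> norm (z - a) \<Longrightarrow> bump_kernel a r z = 0"
  by (simp add: bump_kernel_def flat_exp_eq_0 paraboloid_nonpos)

lemma continuous_on_bump_kernel: "0 < r \<Longrightarrow> continuous_on S (bump_kernel a r)"
  unfolding bump_kernel_def[abs_def] by (intro continuous_intros) auto

lemma continuous_on_laplacian_bump: "0 < r \<Longrightarrow> continuous_on S (laplacian (bump a r))"
  unfolding laplacian_bump[abs_def] by (intro continuous_intros) auto

text \<open>The key identity: changing the radius changes the kernel by a multiple of the Laplacian of a test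
  function. With \<open>s = \<bar>z - a\<bar>\<^sup>2 / r\<^sup>2\<close> and \<open>\<kappa> s = flat_exp 2 (1 - s)\<close>, both sides are
  \<open>- 2 / r ^ 3 * d/ds (s * \<kappa> s)\<close>.\<close>

lemma DERIV_bump_kernel:
  assumes "0 < r"
  shows "((\<lambda>r. bump_kernel a r z) has_real_derivative laplacian (bump a r) z / (2 * r)) (at r)"
proof -
  let ?D = "\<lambda>p. flat_exp 4 p - 2 * flat_exp 3 p" and ?p = "paraboloid a r z"
  have p: "((\<lambda>r. paraboloid a r z) has_real_derivative 2 * (norm (z - a))\<^sup>2 / r ^ 3) (at r)"
    unfolding paraboloid_def dot_square_norm using assms
    by (auto intro!: derivative_eq_intros simp: field_simps power2_eq_square power3_eq_cube)
  have "((\<lambda>r. flat_exp 2 (paraboloid a r z)) has_real_derivative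
      ?D ?p * (2 * (norm (z - a))\<^sup>2 / r ^ 3)) (at r)"
    using DERIV_chain2[OF DERIV_flat_exp[of 2] p] by simp
  then show ?thesis
    unfolding bump_kernel_def laplacian_bump using assms
    by (auto intro!: derivative_eq_intros simp: field_simps power2_eq_square power3_eq_cube power4_eq_xxxx)
qed

text \<open>The square of half side \<open>R\<close> about \<open>a\<close>; integrals of compactly supported functions are taken over
  such squares, where the Henstock-Kurzweil integral admits differentiation under the integral sign.\<close>

definition centred_box :: "complex \<Rightarrow> real \<Rightarrow> complex set" where
  "centred_box a R = cbox (a - Complex R R) (a + Complex R R)"

lemma mem_centred_box: "z \<in> centred_box a R \<longleftrightarrow> \<bar>Re (z - a)\<bar> \<le> R \<and> \<bar>Im (z - a)\<bar> \<le> R"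
  by (auto simp: centred_box_def in_cbox_complex_iff abs_le_iff)

lemma not_in_centred_box: "z \<notin> centred_box a R \<Longrightarrow> R < norm (z - a)"
  using abs_Re_le_cmod[of "z - a"] abs_Im_le_cmod[of "z - a"] by (auto simp: mem_centred_box)

lemma content_centred_box: "0 \<le> R \<Longrightarrow> measure lborel (centred_box a R) = (2 * R)\<^sup>2"
  unfolding centred_box_def
  by (subst content_cbox) (auto simp: Basis_complex_def power2_eq_square)

lemma lborel_integral_compact_support:
  fixes g :: "complex \<Rightarrow> real"
  assumes "continuous_on UNIV g" "\<And>z. z \<notin> cbox a b \<Longrightarrow> g z = 0"
  shows "integrable lborel g" "(\<integral>z. g z \<partial>lborel) = integral (cbox a b) g"
proof -
  have eq: "indicator (cbox a b) z *\<^sub>R g z = g z" for z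
    using assms(2) by (cases "z \<in> cbox a b") auto
  have "integrable lborel (\<lambda>z. indicator (cbox a b) z *\<^sub>R g z)"
    using assms(1) by (intro borel_integrable_compact) (auto intro: continuous_on_subset)
  then show "integrable lborel g" unfolding eq .
  have "set_integrable lborel (cbox a b) g"
    unfolding set_integrable_def by fact
  from set_borel_integral_eq_integral(2)[OF this]
  show "(\<integral>z. g z \<partial>lborel) = integral (cbox a b) g"
    unfolding set_lebesgue_integral_def eq .
qed

text \<open>The unnormalised mean of \<open>u\<close> against the kernel of radius \<open>r\<close> about \<open>a\<close>.\<close>

definition kernel_mean :: "(complex \<Rightarrow> real) \<Rightarrow> complex \<Rightarrow> real \<Rightarrow> real" where
  "kernel_mean u a r = (\<integral>z. u z * bump_kernel a r z \<partial>lborel)"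

lemma kernel_mean_eq_integral:
  assumes "continuous_on UNIV u" "0 < r" "\<And>z. z \<notin> cbox b c \<Longrightarrow> r \<le> norm (z - a)"
  shows "kernel_mean u a r = integral (cbox b c) (\<lambda>z. u z * bump_kernel a r z)"
  unfolding kernel_mean_def using assms
  by (intro lborel_integral_compact_support continuous_intros continuous_on_bump_kernel)
    (auto simp: bump_kernel_eq_0)

lemma lborel_integral_complex_affine:
  fixes g :: "complex \<Rightarrow> real"
  assumes "continuous_on UNIV g" "0 < r"
  shows "(\<integral>z. g z \<partial>lborel) = r\<^sup>2 * (\<integral>z. g (a + r *\<^sub>R z) \<partial>lborel)"
proof -
  have [measurable]: "g \<in> borel_measurable borel"
    using assms(1) by (rule borel_measurable_continuous_onI)
  have "(\<integral>z. g z \<partial>lborel) =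
      (\<integral>z. g z \<partial>density (distr lborel borel (\<lambda>z. a + r *\<^sub>R z)) (\<lambda>_. ennreal (r\<^sup>2)))"
    using lborel_affine[of r a] assms(2) by (simp add: ennreal_power)
  also have "\<dots> = (\<integral>z. r\<^sup>2 *\<^sub>R g z \<partial>distr lborel borel (\<lambda>z. a + r *\<^sub>R z))"
    by (rule integral_density) auto
  also have "\<dots> = (\<integral>z. r\<^sup>2 *\<^sub>R g (a + r *\<^sub>R z) \<partial>lborel)"
    by (rule integral_distr) auto
  finally show ?thesis by simp
qed

lemma kernel_mean_rescaled:
  assumes "continuous_on UNIV u" "0 < r"
  shows "kernel_mean u a r = integral (centred_box 0 1) (\<lambda>z. u (a + r *\<^sub>R z) * bump_kernel 0 1 z)"
proof -
  have scale: "bump_kernel a r (a + r *\<^sub>R z) = bump_kernel 0 1 z / r\<^sup>2" for z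
    using assms(2) by (simp add: bump_kernel_def paraboloid_def power2_eq_square)
  have "kernel_mean u a r = r\<^sup>2 * (\<integral>z. u (a + r *\<^sub>R z) * bump_kernel a r (a + r *\<^sub>R z) \<partial>lborel)"
    unfolding kernel_mean_def
    by (intro lborel_integral_complex_affine continuous_intros continuous_on_bump_kernel assms)
  also have "\<dots> = (\<integral>z. u (a + r *\<^sub>R z) * bump_kernel 0 1 z \<partial>lborel)"
    unfolding scale using assms(2) by simp
  also have "\<dots> = integral (centred_box 0 1) (\<lambda>z. u (a + r *\<^sub>R z) * bump_kernel 0 1 z)"
    unfolding centred_box_def
  proof (intro lborel_integral_compact_support continuous_intros continuous_on_bump_kernel)
    show "continuous_on UNIV (\<lambda>z. u (a + r *\<^sub>R z))"
      by (rule continuous_on_compose2[OF assms(1)]) (auto intro!: continuous_intros)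
    fix z :: complex
    assume "z \<notin> cbox (0 - Complex 1 1) (0 + Complex 1 1)"
    then show "u (a + r *\<^sub>R z) * bump_kernel 0 1 z = 0"
      using not_in_centred_box[of z 0 1] bump_kernel_eq_0[of 1 z 0] by (simp add: centred_box_def)
  qed simp
  finally show ?thesis .
qed

lemma kernel_mean_radius_independent:
  assumes u: "continuous_on UNIV u"
    and weak: "\<And>f. test_function f \<Longrightarrow> distr_laplacian u f = 0"
    and rs: "0 < r" "0 < s"
  shows "kernel_mean u a r = kernel_mean u a s"
proof -
  define R where "R = r + s"
  let ?b = "a - Complex R R" and ?c = "a + Complex R R"
  have out: "t \<le> norm (z - a)" if "z \<notin> cbox ?b ?c" "t \<in> {0<..<R}" for z t
    using not_in_centred_box[of z a R] that by (simp add: centred_box_def)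
  have "((\<lambda>t. integral (cbox ?b ?c) (\<lambda>z. u z * bump_kernel a t z)) has_real_derivative 0) (at t within {0<..<R})"
    if t: "t \<in> {0<..<R}" for t
  proof -
    have "((\<lambda>t. integral (cbox ?b ?c) (\<lambda>z. u z * bump_kernel a t z)) has_real_derivative
        integral (cbox ?b ?c) (\<lambda>z. u z * (laplacian (bump a t) z / (2 * t)))) (at t within {0<..<R})"
    proof (rule leibniz_rule_field_derivative[where U = "{0<..<R}"])
      fix t z assume "t \<in> {0<..<R}"
      then show "((\<lambda>t. u z * bump_kernel a t z) has_real_derivative
          u z * (laplacian (bump a t) z / (2 * t))) (at t within {0<..<R})"
        by (intro DERIV_cmult DERIV_subset[OF DERIV_bump_kernel]) auto
    next
      fix t assume "t \<in> {0<..<R}"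
      then show "(\<lambda>z. u z * bump_kernel a t z) integrable_on cbox ?b ?c"
        using u by (intro integrable_continuous continuous_intros continuous_on_bump_kernel)
          (auto intro: continuous_on_subset)
    next
      have "continuous_on ({0<..<R} \<times> cbox ?b ?c)
          (\<lambda>x. u (snd x) * (laplacian (bump a (fst x)) (snd x) / (2 * fst x)))"
        unfolding laplacian_bump
        by (intro continuous_intros continuous_on_compose2[OF u]) auto
      then show "continuous_on ({0<..<R} \<times> cbox ?b ?c)
          (\<lambda>(t, z). u z * (laplacian (bump a t) z / (2 * t)))"
        by (simp add: split_beta)
    qed (use t in auto)
    moreover have "integral (cbox ?b ?c) (\<lambda>z. u z * (laplacian (bump a t) z / (2 * t))) = 0"
    proof -
      have "(\<integral>z. u z * laplacian (bump a t) z \<partial>lborel) =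
          integral (cbox ?b ?c) (\<lambda>z. u z * laplacian (bump a t) z)"
        using t out[OF _ t] u
        by (intro lborel_integral_compact_support continuous_intros continuous_on_laplacian_bump)
          (auto simp: laplacian_bump_eq_0)
      moreover have "(\<integral>z. u z * laplacian (bump a t) z \<partial>lborel) = 0"
        using weak[OF test_function_bump[of t a]] t by (simp add: distr_laplacian_def)
      ultimately have "integral (cbox ?b ?c) (\<lambda>z. u z * laplacian (bump a t) z / (2 * t)) = 0"
        by simp
      then show ?thesis by simp
    qed
    ultimately show ?thesis by (simp only:)
  qed
  from has_field_derivative_zero_constant[OF _ this]
  obtain C where C: "\<And>t. t \<in> {0<..<R} \<Longrightarrow> integral (cbox ?b ?c) (\<lambda>z. u z * bump_kernel a t z) = C"
    by auto
  have "kernel_mean u a t = C" if "t \<in> {0<..<R}" for t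
    using kernel_mean_eq_integral[OF u _ out] that C by simp
  then show ?thesis using rs by (simp add: R_def)
qed

text \<open>The total mass of the kernel, for any centre and positive radius.\<close>

definition kernel_mass :: real where
  "kernel_mass = integral (centred_box 0 1) (bump_kernel 0 1)"

lemma kernel_mass_nonzero: "kernel_mass \<noteq> 0"
proof
  assume "kernel_mass = 0"
  then have "(bump_kernel 0 1 has_integral 0) (centred_box 0 1)"
    unfolding kernel_mass_def centred_box_def
    by (metis integrable_integral integrable_continuous continuous_on_bump_kernel zero_less_one)
  then have "bump_kernel 0 1 0 = 0"
    unfolding centred_box_def
    by (rule has_integral_0_cbox_imp_0[OF continuous_on_bump_kernel, rotated 2])
      (auto simp: bump_kernel_def flat_exp_nonneg box_ne_empty Basis_complex_def in_cbox_complex_iff)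
  then show False
    by (simp add: bump_kernel_def flat_exp_def paraboloid_def)
qed

text \<open>The mean value property of a weakly harmonic continuous function: the mean is independent of the
  radius, and the rescaled integral is continuous at radius 0.\<close>

lemma kernel_mean_eq:
  assumes u: "continuous_on UNIV u"
    and weak: "\<And>f. test_function f \<Longrightarrow> distr_laplacian u f = 0"
    and r: "0 < r"
  shows "kernel_mean u a r = kernel_mass * u a"
proof -
  define M where "M = (\<lambda>t. integral (centred_box 0 1) (\<lambda>z. u (a + t *\<^sub>R z) * bump_kernel 0 1 z))"
  have "continuous_on UNIV M"
    unfolding M_def centred_box_def
  proof (rule integral_continuous_on_param)
    have "continuous_on (UNIV \<times> cbox (0 - Complex 1 1) (0 + Complex 1 1))
        (\<lambda>x. u (a + fst x *\<^sub>R snd x) * bump_kernel 0 1 (snd x))"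
      by (intro continuous_intros continuous_on_compose2[OF u]
          continuous_on_compose2[OF continuous_on_bump_kernel[of 1 UNIV]]) auto
    then show "continuous_on (UNIV \<times> cbox (0 - Complex 1 1) (0 + Complex 1 1))
        (\<lambda>(t, z). u (a + t *\<^sub>R z) * bump_kernel 0 1 z)"
      by (simp add: split_beta)
  qed
  then have "isCont M 0"
    by (simp add: continuous_on_eq_continuous_at)
  then have "(M \<longlongrightarrow> M 0) (at_right 0)"
    by (simp add: isCont_def filterlim_at_split)
  moreover have "\<forall>\<^sub>F t in at_right 0. M t = kernel_mean u a r"
  proof -
    have "M t = kernel_mean u a r" if "0 < t" for t
      using kernel_mean_rescaled[OF u that] kernel_mean_radius_independent[OF u weak that r]
      by (simp add: M_def)
    then show ?thesis by (simp add: eventually_at_filter)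
  qed
  ultimately have "((\<lambda>_. kernel_mean u a r) \<longlongrightarrow> M 0) (at_right (0 :: real))"
    by (rule Lim_transform_eventually)
  then have "M 0 = kernel_mean u a r"
    by (simp add: tendsto_const_iff)
  then show ?thesis
    by (simp add: M_def kernel_mass_def mult.commute)
qed

text \<open>The kernel is radial, \<open>h (\<bar>z - a\<bar> / r) / r\<^sup>2\<close> with \<open>h\<close> Lipschitz on the real line.\<close>

lemma bump_kernel_Lipschitz:
  obtains L where "0 \<le> L"
    "\<And>a b r z. 0 < r \<Longrightarrow> \<bar>bump_kernel a r z - bump_kernel b r z\<bar> \<le> L * norm (a - b) / r ^ 3"
proof -
  define h where "h y = flat_exp 2 (1 - y\<^sup>2)" for y
  define h' where "h' y = (flat_exp 4 (1 - y\<^sup>2) - 2 * flat_exp 3 (1 - y\<^sup>2)) * (- 2 * y)" for y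
  have h: "(h has_real_derivative h' y) (at y)" for y
  proof -
    have "((\<lambda>y. 1 - y\<^sup>2) has_real_derivative - 2 * y) (at y)"
      by (auto intro!: derivative_eq_intros)
    from DERIV_chain2[OF DERIV_flat_exp[of 2] this] show ?thesis
      unfolding h_def[abs_def] h'_def by simp
  qed
  have "compact (h' ` {-1..1})"
    unfolding h'_def[abs_def] by (intro compact_continuous_image continuous_intros) auto
  then obtain L where L: "0 < L" "\<And>y. y \<in> {-1..1} \<Longrightarrow> \<bar>h' y\<bar> \<le> L"
    by (auto dest!: compact_imp_bounded simp: bounded_pos)
  have bound: "\<bar>h' y\<bar> \<le> L" for y
  proof (cases "y \<in> {-1..1}")
    case False
    then have "1 \<le> \<bar>y\<bar>" by auto
    then have "1 - y\<^sup>2 \<le> 0" using abs_le_square_iff[of 1 y] by simp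
    then show ?thesis using L(1) by (simp add: h'_def flat_exp_eq_0)
  qed (use L in auto)
  have lip: "\<bar>h x - h y\<bar> \<le> L * \<bar>x - y\<bar>" for x y
    using field_differentiable_bound[of UNIV h h' L x y] h bound by (simp add: has_field_derivative_at_within)
  have "\<bar>bump_kernel a r z - bump_kernel b r z\<bar> \<le> L * norm (a - b) / r ^ 3" if r: "0 < r" for a b z r
  proof -
    have k: "bump_kernel c r z = h (norm (z - c) / r) / r\<^sup>2" for c
      by (simp add: bump_kernel_def h_def paraboloid_def dot_square_norm power_divide)
    have "\<bar>bump_kernel a r z - bump_kernel b r z\<bar> = \<bar>h (norm (z - a) / r) - h (norm (z - b) / r)\<bar> / r\<^sup>2"
      unfolding k by (simp add: diff_divide_distrib[symmetric])
    also have "\<dots> \<le> L * \<bar>norm (z - a) / r - norm (z - b) / r\<bar> / r\<^sup>2"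
      by (intro divide_right_mono lip) auto
    also have "\<dots> = L * \<bar>norm (z - a) - norm (z - b)\<bar> / r ^ 3"
      using r by (simp add: diff_divide_distrib[symmetric] power2_eq_square power3_eq_cube)
    also have "\<dots> \<le> L * norm (a - b) / r ^ 3"
      using r L(1) norm_triangle_ineq3[of "z - a" "z - b"]
      by (intro divide_right_mono mult_left_mono) (auto simp: norm_minus_commute)
    finally show ?thesis .
  qed
  with L(1) that[of L] show ?thesis by simp
qed

text \<open>Liouville's theorem for weakly harmonic functions of sublinear growth. Up to the factor
  \<open>kernel_mass\<close>, the difference of the values at \<open>a\<close> and \<open>b\<close> is an integral over a square of side \<open>4 r\<close> of \<open>u\<close>, which is at most \<open>B + O(e r)\<close>
  there, against a difference of kernels of size \<open>O(r ^ -3)\<close>. As \<open>r\<close> tends to infinity it is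
  therefore \<open>O(e)\<close>.\<close>

theorem weakly_harmonic_sublinear_imp_constant:
  fixes u :: "complex \<Rightarrow> real"
  assumes u: "continuous_on UNIV u"
    and weak: "\<And>f. test_function f \<Longrightarrow> distr_laplacian u f = 0"
    and growth: "\<And>e. 0 < e \<Longrightarrow> \<exists>B. \<forall>z. \<bar>u z\<bar> \<le> B + e * norm z"
  shows "u a = u b"
proof -
  obtain L where L: "0 \<le> L"
    "\<And>a b r z. 0 < r \<Longrightarrow> \<bar>bump_kernel a r z - bump_kernel b r z\<bar> \<le> L * norm (a - b) / r ^ 3"
    using bump_kernel_Lipschitz by blast
  define A where "A = 16 * L * norm (a - b)"
  have A: "0 \<le> A" using L(1) by (simp add: A_def)
  have "\<bar>kernel_mass * u a - kernel_mass * u b\<bar> \<le> A * (4 * e)" if e: "0 < e" for e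
  proof -
    from growth[OF e] obtain B where B: "\<And>z. \<bar>u z\<bar> \<le> B + e * norm z" by blast
    have est: "\<bar>kernel_mass * u a - kernel_mass * u b\<bar> \<le> A * ((B + e * norm a) / r + 4 * e)"
      if r: "0 < r" "norm (a - b) \<le> r" for r
    proof -
      let ?b = "a - Complex (2 * r) (2 * r)" and ?c = "a + Complex (2 * r) (2 * r)"
      have far: "2 * r < norm (z - a)" if "z \<notin> cbox ?b ?c" for z
        using not_in_centred_box[of z a "2 * r"] that by (simp add: centred_box_def)
      \<comment> \<open>Half side \<open>2 r\<close> makes the square contain the supports of both kernels.\<close>
      have out: "r \<le> norm (z - a)" "r \<le> norm (z - b)" if "z \<notin> cbox ?b ?c" for z
        using far[OF that] r norm_triangle_ineq[of "z - b" "b - a"] by (auto simp: norm_minus_commute)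
      have int: "(\<lambda>z. u z * bump_kernel c r z) integrable_on cbox ?b ?c" for c
        using u r by (intro integrable_continuous continuous_intros continuous_on_bump_kernel)
          (auto intro: continuous_on_subset)
      have "kernel_mass * u a - kernel_mass * u b = kernel_mean u a r - kernel_mean u b r"
        using kernel_mean_eq[OF u weak r(1)] by simp
      also have "\<dots> = integral (cbox ?b ?c) (\<lambda>z. u z * bump_kernel a r z - u z * bump_kernel b r z)"
        using kernel_mean_eq_integral[OF u r(1) out(1)] kernel_mean_eq_integral[OF u r(1) out(2)]
        by (simp add: integral_diff int)
      also have "\<bar>\<dots>\<bar> \<le> (B + e * (norm a + 4 * r)) * (L * norm (a - b) / r ^ 3) * measure lborel (cbox ?b ?c)"
        unfolding real_norm_def[symmetric]
      proof (rule has_integral_bound[OF _ integrable_integral[OF integrable_diff[OF int int]]])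
        have "0 \<le> B + e * norm a" "0 \<le> e * (4 * r)" using B[of a] e r by auto
        then have "0 \<le> B + e * (norm a + 4 * r)" unfolding distrib_left by linarith
        then show "0 \<le> (B + e * (norm a + 4 * r)) * (L * norm (a - b) / r ^ 3)"
          using e r L(1) by (intro mult_nonneg_nonneg) auto
        fix z assume "z \<in> cbox ?b ?c"
        then have "\<bar>Re (z - a)\<bar> \<le> 2 * r" "\<bar>Im (z - a)\<bar> \<le> 2 * r"
          using mem_centred_box[of z a "2 * r"] by (simp_all add: centred_box_def)
        then have "norm (z - a) \<le> 4 * r"
          using cmod_le[of "z - a"] by linarith
        then have "norm z \<le> norm a + 4 * r"
          using norm_triangle_sub[of z a] by linarith
        then have "\<bar>u z\<bar> \<le> B + e * (norm a + 4 * r)"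
          using B[of z] e mult_left_mono[of "norm z" "norm a + 4 * r" e] by linarith
        then have "\<bar>u z\<bar> * \<bar>bump_kernel a r z - bump_kernel b r z\<bar>
            \<le> (B + e * (norm a + 4 * r)) * (L * norm (a - b) / r ^ 3)"
          using L(2)[OF r(1)] by (intro mult_mono) auto
        then show "norm (u z * bump_kernel a r z - u z * bump_kernel b r z)
            \<le> (B + e * (norm a + 4 * r)) * (L * norm (a - b) / r ^ 3)"
          by (simp add: right_diff_distrib[symmetric] abs_mult)
      qed
      also have "measure lborel (cbox ?b ?c) = (4 * r)\<^sup>2"
        using content_centred_box[of "2 * r" a] r by (simp add: centred_box_def)
      also have "(B + e * (norm a + 4 * r)) * (L * norm (a - b) / r ^ 3) * (4 * r)\<^sup>2 =
          A * ((B + e * norm a) / r + 4 * e)"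
        using r by (simp add: A_def field_simps power2_eq_square power3_eq_cube)
      finally show ?thesis .
    qed
    have "((\<lambda>r. A * ((B + e * norm a) / r + 4 * e)) \<longlongrightarrow> A * (0 + 4 * e)) at_top"
      by (intro tendsto_intros tendsto_divide_0[OF tendsto_const] filterlim_at_top_imp_at_infinity
          filterlim_ident)
    moreover have "\<forall>\<^sub>F r in at_top. \<bar>kernel_mass * u a - kernel_mass * u b\<bar>
        \<le> A * ((B + e * norm a) / r + 4 * e)"
      using eventually_gt_at_top[of 0] eventually_ge_at_top[of "norm (a - b)"]
      by eventually_elim (rule est)
    ultimately show ?thesis
      using tendsto_lowerbound[of _ "A * (0 + 4 * e)" at_top] by fastforce
  qed
  note small = this
  have "\<bar>kernel_mass * u a - kernel_mass * u b\<bar> \<le> 0"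
  proof (rule field_le_epsilon)
    fix d :: real assume d: "0 < d"
    have "A * (4 * (d / (4 * (A + 1)))) \<le> d"
      using A d by (simp add: field_simps)
    with small[of "d / (4 * (A + 1))"] A d
    show "\<bar>kernel_mass * u a - kernel_mass * u b\<bar> \<le> 0 + d" by simp
  qed
  then show ?thesis
    using kernel_mass_nonzero by (simp add: right_diff_distrib[symmetric])
qed

section \<open>Distinctness of the bifurcation measures\<close>

lemma dir_deriv_eq_0:
  assumes "open S" "z \<in> S" "\<And>w. w \<in> S \<Longrightarrow> f w = 0"
  shows "dir_deriv v f z = 0"
proof -
  have "((\<lambda>_. 0) has_derivative (\<lambda>_. 0)) (at z)" by simp
  then have "(f has_derivative (\<lambda>_. 0)) (at z)"
    by (rule has_derivative_transform_within_open[OF _ assms(1,2)]) (use assms(3) in simp)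
  then show ?thesis by (rule dir_deriv_eq)
qed

lemma integrable_mult_laplacian:
  assumes u: "continuous_on UNIV u" and f: "test_function f"
  shows "integrable lborel (\<lambda>z. u z * laplacian f z)"
proof -
  let ?K = "closure {z. f z \<noteq> 0}"
  from f have "bounded ?K"
    by (auto simp: test_function_def compact_imp_bounded)
  then obtain c where c: "?K \<subseteq> cbox (- c) c"
    using bounded_subset_cbox_symmetric by metis
  have "continuous_on UNIV (dir_deriv v (dir_deriv v f))" for v
  proof -
    have "foldr dir_deriv [v, v] f differentiable_on UNIV"
      using f unfolding test_function_def smooth_def by blast
    then show ?thesis by (simp add: differentiable_imp_continuous_on)
  qed
  then have cont: "continuous_on UNIV (laplacian f)"
    unfolding laplacian_def[abs_def] by (intro continuous_intros)
  have zero: "dir_deriv v f z = 0" if "z \<in> - ?K" for v z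
    using that closure_subset[of "{z. f z \<noteq> 0}"] by (intro dir_deriv_eq_0[of "- ?K"]) auto
  have "dir_deriv v (dir_deriv v f) z = 0" if "z \<in> - ?K" for v z
    by (rule dir_deriv_eq_0[of "- ?K", OF _ that]) (auto intro: zero)
  then have "laplacian f z = 0" if "z \<in> - ?K" for z
    using that by (simp add: laplacian_def)
  with c show ?thesis
    by (intro lborel_integral_compact_support(1)[of _ "- c" c] continuous_intros u cont) auto
qed

lemma distr_laplacian_diff:
  assumes "continuous_on UNIV u" "continuous_on UNIV v" "test_function f"
  shows "distr_laplacian (\<lambda>z. u z - v z) f = distr_laplacian u f - distr_laplacian v f"
  using assms by (simp add: distr_laplacian_def left_diff_distrib integrable_mult_laplacian)

theorem theorem1p2:
  fixes lam :: complex and mu_plus mu_minus :: "complex measure"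
  assumes "lam \<noteq> 0"
    and "is_bifurcation_measure lam 1 mu_plus"
    and "is_bifurcation_measure lam (-1) mu_minus"
  shows "mu_plus \<noteq> mu_minus"
proof
  assume eq: "mu_plus = mu_minus"
  define u where "u = (\<lambda>t. bif_potential lam 1 t - bif_potential lam (-1) t)"
  have "continuous_on UNIV u"
    unfolding u_def by (intro continuous_intros continuous_on_bif_potential assms(1))
  moreover have "distr_laplacian u f = 0" if f: "test_function f" for f
  proof -
    have "(\<integral>z. f z \<partial>mu_plus) = 1 / (2 * pi) * distr_laplacian (bif_potential lam 1) f"
      "(\<integral>z. f z \<partial>mu_minus) = 1 / (2 * pi) * distr_laplacian (bif_potential lam (-1)) f"
      using assms(2,3) f unfolding is_bifurcation_measure_def by blast+
    then have "distr_laplacian (bif_potential lam 1) f = distr_laplacian (bif_potential lam (-1)) f"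
      unfolding eq by simp
    then show ?thesis
      unfolding u_def
      by (simp add: distr_laplacian_diff[OF continuous_on_bif_potential continuous_on_bif_potential f]
          assms(1))
  qed
  moreover have "\<exists>B. \<forall>t. \<bar>u t\<bar> \<le> B + e * norm t" if "0 < e" for e
  proof (intro exI allI)
    fix t :: complex
    let ?K = "lift_const lam"
    have pos: "0 < e / 2 * (1 + norm t)" "0 < 2 * ?K / e"
      using that lift_const_gt_1[of lam] by (auto intro!: mult_pos_pos add_pos_nonneg)
    \<comment> \<open>Splitting off a factor \<open>e / 2\<close> turns \<open>ln x \<le> x - 1\<close> into a bound of arbitrarily small slope.\<close>
    have "?K * (1 + norm t) = e / 2 * (1 + norm t) * (2 * ?K / e)"
      using that by (simp add: field_simps)
    then have "ln (?K * (1 + norm t)) = ln (e / 2 * (1 + norm t)) + ln (2 * ?K / e)"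
      using pos by (simp only: ln_mult_pos)
    moreover have "ln (e / 2 * (1 + norm t)) \<le> e / 2 * (1 + norm t)"
      using ln_le_minus_one[OF pos(1)] by linarith
    moreover have "\<bar>u t\<bar> \<le> 2 * ln (?K * (1 + norm t))"
      using bif_potential_growth[OF assms(1), of 1 t] bif_potential_growth[OF assms(1), of "-1" t]
      by (simp add: u_def)
    ultimately show "\<bar>u t\<bar> \<le> (e + 2 * ln (2 * ?K / e)) + e * norm t"
      by (simp add: algebra_simps)
  qed
  ultimately have "u (-2) = u 2"
    by (rule weakly_harmonic_sublinear_imp_constant)
  moreover have "u 2 = - u (-2)"
    using bif_potential_minus[of lam 1 2] bif_potential_minus[of lam "-1" 2] by (simp add: u_def)
  ultimately have "u (-2) = 0" by simp
  then show False
    using bif_potential_plus_at_minus_2[OF assms(1)] bif_potential_minus_at_minus_2[OF assms(1)]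
    by (simp add: u_def)
qed

end
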